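(* Let $T=\bigcup_\alpha T_\alpha$ be the (local) generalized solution in $x^0$ of the system $F_j(x)=0$, $j=1,\dots,l$. Let $M\subset\overline\Omega$ be the connected component containing $x^0$ of the solution set $\{x\in\overline\Omega: F_j(x)=0,\ j=1,\dots,l\}$. Then, for all $\alpha$, $$x^0\in T_\alpha\subset T\subset\partial M_{x^0},$$ where $\partial M_{x^0}$ is the connected component of $\partial M$ (the boundary of $M$) containing $x^0$. In particular, $F_j(x)=0$, $j=1,\dots,l$, for all $x\in T$.
   Context: Setting: $1\le l\le d-1$ are integers, $\Omega\subset\mathbb{R}^d$ is a bounded domain, $x^0\in\Omega$, $F_1,\dots,F_l\in C^1(\Omega)$ are real valued, continuous on $\overline\Omega$, with $F_j(x^0)=0$, $j=1,\dots,l$. $J(x)$ denotes the Jacobian matrix of $(F_1,\dots,F_l)$ at $x\in\Omega$. It is not assumed that $J(x^0)$ has rank $l$ ($x^0$ may be critical), but it is assumed that there is at least one sequence $\{x^n\}\subset\Omega$ with $$x^n\to x^0,\qquad \operatorname{rank}J(x^n)=l\ \ \forall n.\qquad( * )$$ Local solution manifolds: to each $z\in\Omega$ with $\operatorname{rank}J(z)=l$ is associated the local solution manifold $S(z)$ of the system $F_j(x)-F_j(z)=0$, $j=1,\dots,l$, around $z$, provided by the implicit function theorem (or the equivalent local ODE construction); it is a connected $(d-l)$-dimensional manifold with $z\in S(z)\subset\{x\in\Omega: F_j(x)=F_j(z),\ j=1,\dots,l,\ \operatorname{rank}J(x)=l\}$. The assignment $z\mapsto S(z)$ is fixed. Generalized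 solution: for a sequence satisfying $( * )$ let $T_n$ be the closure in $\overline\Omega$ of $S(x^n)$, a compact connected set. Since $\Omega$ is bounded, on a subsequence (denoted by $\alpha$) one has $T_n\to T_\alpha$ in the Hausdorff–Pompeiu metric, with $T_\alpha$ a compact connected subset of $\mathbb{R}^d$. The (local) generalized solution in $x^0$ is $T=\bigcup_\alpha T_\alpha$, the union being taken over all sequences satisfying $( * )$ and all their subsequences along which $T_n$ converges. *)

theory Defs
  imports "HOL-Analysis.Analysis"
begin

definition C1_on :: "(real^'d \<Rightarrow> real^'l) \<Rightarrow> (real^'d) set \<Rightarrow> bool" where
  "C1_on F \<Omega> \<longleftrightarrow> (\<forall>x\<in>\<Omega>. F differentiable (at x)) \<and> continuous_on \<Omega> (\<lambda>x. jacobian F (at x))"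

definition regular_points :: "(real^'d \<Rightarrow> real^'l) \<Rightarrow> (real^'d) set \<Rightarrow> (real^'d) set" where
  "regular_points F \<Omega> = {x \<in> \<Omega>. rank (jacobian F (at x)) = CARD('l)}"

(* Only the topological structure is recorded; for a subset of a Euclidean space the Hausdorff and
   second countability axioms hold automatically. *)
definition topological_manifold :: "nat \<Rightarrow> 'a::euclidean_space set \<Rightarrow> bool" where
  "topological_manifold k S \<longleftrightarrow>
     (\<forall>p\<in>S. \<exists>U V. openin (top_of_set S) U \<and> p \<in> U \<and> openin (Euclidean_space k) V \<and>
        top_of_set U homeomorphic_space subtopology (Euclidean_space k) V)"

(* Near z such an S coincides with the level set of F through z: by the implicit function theorem
   the set on the right of the inclusion is itself a manifold of the same dimension as S, so S is
   open in it by invariance of domain. *)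
definition local_solution_manifold ::
  "(real^'d \<Rightarrow> real^'l) \<Rightarrow> (real^'d) set \<Rightarrow> real^'d \<Rightarrow> (real^'d) set \<Rightarrow> bool" where
  "local_solution_manifold F \<Omega> z S \<longleftrightarrow>
     connected S \<and> topological_manifold (CARD('d) - CARD('l)) S \<and>
     z \<in> S \<and> S \<subseteq> {x \<in> regular_points F \<Omega>. F x = F z}"

(* The Hausdorff-Pompeiu distance; meaningful for nonempty bounded sets. *)
definition hausdorff_dist :: "'a::metric_space set \<Rightarrow> 'a set \<Rightarrow> real" where
  "hausdorff_dist A B = max (SUP a\<in>A. infdist a B) (SUP b\<in>B. infdist b A)"

definition hausdorff_limit :: "(nat \<Rightarrow> 'a::metric_space set) \<Rightarrow> 'a set \<Rightarrow> bool" where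
  "hausdorff_limit T K \<longleftrightarrow>
     compact K \<and> K \<noteq> {} \<and> (\<lambda>n. hausdorff_dist (T n) K) \<longlonglongrightarrow> 0"

definition regular_sequence ::
  "(real^'d \<Rightarrow> real^'l) \<Rightarrow> (real^'d) set \<Rightarrow> real^'d \<Rightarrow> (nat \<Rightarrow> real^'d) \<Rightarrow> bool" where
  "regular_sequence F \<Omega> x0 x \<longleftrightarrow> (\<forall>n. x n \<in> regular_points F \<Omega>) \<and> x \<longlonglongrightarrow> x0"

(* The family of all limit sets T_alpha. Since S (x n) is contained in \<Omega>, its closure in
   closure \<Omega> is its closure in the whole space. *)
definition limit_sets ::
  "(real^'d \<Rightarrow> real^'l) \<Rightarrow> (real^'d) set \<Rightarrow> (real^'d \<Rightarrow> (real^'d) set) \<Rightarrow> real^'d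
    \<Rightarrow> (real^'d) set set" where
  "limit_sets F \<Omega> S x0 =
     {K. \<exists>x r. regular_sequence F \<Omega> x0 x \<and> strict_mono r \<and>
           hausdorff_limit (\<lambda>n. closure (S (x (r n)))) K}"

definition generalized_solution ::
  "(real^'d \<Rightarrow> real^'l) \<Rightarrow> (real^'d) set \<Rightarrow> (real^'d \<Rightarrow> (real^'d) set) \<Rightarrow> real^'d
    \<Rightarrow> (real^'d) set" where
  "generalized_solution F \<Omega> S x0 = \<Union> (limit_sets F \<Omega> S x0)"

end

theory Submission
  imports Defs
begin

text \<open>A limit of the sets \<open>closure (S (x n))\<close> is connected, contains \<open>x0\<close>, and consists of zeros of
  \<open>F\<close>, since \<open>F\<close> is constantly \<open>F (x n)\<close> on \<open>closure (S (x n))\<close>; hence it lies in \<open>M\<close>. Near a point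
  of the interior of \<open>M\<close> the map \<open>F\<close> vanishes identically, so its Jacobian has rank \<open>0\<close> there, whereas
  every point of \<open>S (x n)\<close> has rank \<open>l \<ge> 1\<close>. So the limits avoid the interior of \<open>M\<close>.\<close>

lemma hausdorff_dist_commute: "hausdorff_dist A B = hausdorff_dist B A"
  by (simp add: hausdorff_dist_def max.commute)

text \<open>Boundedness of \<open>A\<close> makes the supremum over \<open>A\<close> a genuine one:
  a real \<open>Sup\<close> says nothing about a set without an upper bound.\<close>

lemma infdist_le_hausdorff_dist:
  assumes "bounded A" "B \<noteq> {}" "a \<in> A"
  shows "infdist a B \<le> hausdorff_dist A B"
proof -
  obtain b where b: "b \<in> B" using assms by blast
  obtain e where e: "\<forall>a\<in>A. dist b a \<le> e" using assms(1) bounded_any_center by blast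
  have "bdd_above ((\<lambda>a. infdist a B) ` A)"
  proof (rule bdd_aboveI2)
    fix a assume "a \<in> A"
    then show "infdist a B \<le> e"
      using e infdist_le[OF b, of a] by (force simp: dist_commute)
  qed
  then have "infdist a B \<le> (SUP a\<in>A. infdist a B)"
    using assms(3) by (intro cSUP_upper)
  then show ?thesis by (simp add: hausdorff_dist_def)
qed

lemma infdist_lessE:
  assumes "infdist x A < e" "A \<noteq> {}"
  obtains a where "a \<in> A" "dist x a < e"
  using assms by (force simp: infdist_notempty cINF_less_iff)

text \<open>\<open>infdist (t n) K\<close> is squeezed to 0 by the Hausdorff distance,
  \<open>infdist\<close> is continuous in the point, and the compact set \<open>K\<close> is closed.
  This will put \<open>x0\<close> into every limit set.\<close>

lemma hausdorff_limit_contains_limits: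
  assumes K: "hausdorff_limit T K" and T: "\<And>n. bounded (T n)" "\<And>n. t n \<in> T n"
    and t: "t \<longlonglongrightarrow> x"
  shows "x \<in> K"
proof -
  have K': "compact K" "K \<noteq> {}" "(\<lambda>n. hausdorff_dist (T n) K) \<longlonglongrightarrow> 0"
    using K by (auto simp: hausdorff_limit_def)
  have "(\<lambda>n. infdist (t n) K) \<longlonglongrightarrow> 0"
    by (rule tendsto_sandwich[OF _ _ tendsto_const K'(3)])
      (auto intro!: always_eventually infdist_nonneg infdist_le_hausdorff_dist T K'(2))
  moreover have "(\<lambda>n. infdist (t n) K) \<longlonglongrightarrow> infdist x K"
    using t by (rule tendsto_infdist)
  ultimately have "infdist x K = 0" by (rule LIMSEQ_unique[rotated])
  then show ?thesis
    using K' by (simp add: in_closed_iff_infdist_zero compact_imp_closed)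
qed

text \<open>This rests on the other half of the Hausdorff distance, the one that measures how far
  points of \<open>K\<close> are from \<open>T n\<close>. It transfers pointwise information about
  the approximating sets to \<open>K\<close>.\<close>

lemma hausdorff_limit_point_sequence:
  assumes K: "hausdorff_limit T K" and T: "\<And>n. T n \<noteq> {}" and y: "y \<in> K"
  obtains t where "\<And>n. t n \<in> T n" "t \<longlonglongrightarrow> y"
proof -
  have K': "bounded K" "(\<lambda>n. hausdorff_dist (T n) K) \<longlonglongrightarrow> 0"
    using K by (auto simp: hausdorff_limit_def compact_imp_bounded)
  \<comment> \<open>The infimum \<open>infdist y (T n)\<close> need not be attained; the vanishing
    slack makes the inequality strict, so that a point of \<open>T n\<close> realizes it.\<close>
  have "\<exists>a\<in>T n. dist y a < hausdorff_dist (T n) K + inverse (real (Suc n))" for n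
  proof -
    have "infdist y (T n) \<le> hausdorff_dist (T n) K"
      using infdist_le_hausdorff_dist[OF K'(1) T y] by (simp add: hausdorff_dist_commute)
    also have "\<dots> < hausdorff_dist (T n) K + inverse (real (Suc n))" by simp
    finally show ?thesis
      using T infdist_lessE by blast
  qed
  then obtain t where t: "\<And>n. t n \<in> T n"
    "\<And>n. dist y (t n) < hausdorff_dist (T n) K + inverse (real (Suc n))"
    by metis
  have "(\<lambda>n. hausdorff_dist (T n) K + inverse (real (Suc n))) \<longlonglongrightarrow> 0"
    using tendsto_add[OF K'(2) LIMSEQ_inverse_real_of_nat] by simp
  then have "(\<lambda>n. dist (t n) y) \<longlonglongrightarrow> 0"
    by (rule tendsto_sandwich[OF _ _ tendsto_const, rotated 2])
      (use t(2) in \<open>auto simp: dist_commute intro!: always_eventually less_imp_le\<close>)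
  then show thesis
    using that t(1) tendsto_dist_iff by blast
qed

text \<open>A splitting of \<open>K\<close> into two closed pieces thickens, by normality, to
  disjoint open sets \<open>U\<close> and \<open>V\<close>. For large \<open>n\<close> the set
  \<open>T n\<close> lies in their union and meets both, since each piece contains a limit of points
  of the \<open>T n\<close>. This contradicts connectedness of \<open>T n\<close>.\<close>

lemma hausdorff_limit_connected:
  fixes T :: "nat \<Rightarrow> 'a::metric_space set"
  assumes K: "hausdorff_limit T K"
    and T: "\<And>n. bounded (T n)" "\<And>n. T n \<noteq> {}" "\<And>n. connected (T n)"
  shows "connected K"
proof (rule ccontr)
  assume "\<not> connected K"
  have K': "compact K" "K \<noteq> {}" "(\<lambda>n. hausdorff_dist (T n) K) \<longlonglongrightarrow> 0"
    using K by (auto simp: hausdorff_limit_def)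
  obtain A B where AB: "closed A" "closed B" "A \<noteq> {}" "B \<noteq> {}" "A \<inter> B = {}" "A \<union> B = K"
    using \<open>\<not> connected K\<close> K'(1) by (auto simp: connected_closed_set compact_imp_closed)
  then obtain U V where UV: "open U" "open V" "A \<subseteq> U" "B \<subseteq> V" "U \<inter> V = {}"
    using t4_space[of A B] by metis
  obtain a b where ab: "a \<in> A" "b \<in> B" using AB by blast
  obtain s where s: "\<And>n. s n \<in> T n" "s \<longlonglongrightarrow> a"
    using hausdorff_limit_point_sequence[OF K T(2)] ab(1) AB(6) by blast
  obtain t where t: "\<And>n. t n \<in> T n" "t \<longlonglongrightarrow> b"
    using hausdorff_limit_point_sequence[OF K T(2)] ab(2) AB(6) by blast
  \<comment> \<open>Compactness of \<open>K\<close> gives one radius valid at all its points, so a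
    small Hausdorff distance traps the whole of \<open>T n\<close> in
    \<open>U \<union> V\<close>.\<close>
  obtain e where e: "e > 0" "\<And>x. infdist x K < e \<Longrightarrow> x \<in> U \<union> V"
  proof -
    have "K \<subseteq> U \<union> V" using AB UV by blast
    then obtain e where e: "e > 0" "(\<Union>x\<in>K. ball x e) \<subseteq> U \<union> V"
      using compact_subset_open_imp_ball_epsilon_subset[OF K'(1)] UV by (metis open_Un)
    have "x \<in> U \<union> V" if x: "infdist x K < e" for x
    proof -
      obtain k where "k \<in> K" "dist x k < e"
        using infdist_lessE[OF x K'(2)] .
      then show ?thesis using e(2) by (force simp: dist_commute)
    qed
    with e(1) that show thesis by blast
  qed
  have "\<forall>\<^sub>F n in sequentially. hausdorff_dist (T n) K < e"
    using order_tendstoD(2)[OF K'(3) e(1)] .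
  moreover have "\<forall>\<^sub>F n in sequentially. s n \<in> U"
    using UV ab by (intro topological_tendstoD[OF s(2)]) auto
  moreover have "\<forall>\<^sub>F n in sequentially. t n \<in> V"
    using UV ab by (intro topological_tendstoD[OF t(2)]) auto
  ultimately have "\<forall>\<^sub>F n in sequentially. hausdorff_dist (T n) K < e \<and> s n \<in> U \<and> t n \<in> V"
    by eventually_elim simp
  then obtain n where n: "hausdorff_dist (T n) K < e" "s n \<in> U" "t n \<in> V"
    by (auto dest: eventually_happens)
  have "T n \<subseteq> U \<union> V"
    using n(1) infdist_le_hausdorff_dist[OF T(1) K'(2)] by (meson e(2) le_less_trans subsetI)
  then show False
    using connectedD[OF T(3) UV(1,2), of n] UV(5) n s(1)[of n] t(1)[of n] by blast
qed

lemma regular_points_disjoint_interior_zeros: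
  fixes F :: "real^'d \<Rightarrow> real^'l"
  assumes "\<And>x. x \<in> M \<Longrightarrow> F x = 0"
  shows "regular_points F \<Omega> \<inter> interior M = {}"
proof -
  have False if y: "y \<in> regular_points F \<Omega>" "y \<in> interior M" for y
  proof -
    have D: "(F has_derivative (\<lambda>_. 0)) (at y)"
      by (rule has_derivative_transform_within_open[OF has_derivative_const[of 0] open_interior y(2)])
        (use assms interior_subset[of M] in auto)
    have "jacobian F (at y) = matrix (\<lambda>_. 0)"
      by (simp add: jacobian_def frechet_derivative_at[OF D, symmetric])
    then have "rank (jacobian F (at y)) = 0"
      by (simp add: matrix_def rank_eq_0 vec_eq_iff)
    \<comment> \<open>Rank 0 is not full rank because \<open>CARD('l)\<close> is positive, the index
      type being nonempty; this is the condition that there is at least one equation.\<close>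
    then show False using y(1) by (simp add: regular_points_def)
  qed
  then show ?thesis by blast
qed

theorem proposition2:
  fixes F :: "real^'d \<Rightarrow> real^'l"
    and \<Omega> :: "(real^'d) set"
    and S :: "real^'d \<Rightarrow> (real^'d) set"
    and x0 :: "real^'d"
  assumes "CARD('l) < CARD('d)"
    and "open \<Omega>" "connected \<Omega>" "bounded \<Omega>" "x0 \<in> \<Omega>"
    and "C1_on F \<Omega>" "continuous_on (closure \<Omega>) F" "F x0 = 0"
    and "\<exists>x. regular_sequence F \<Omega> x0 x"
    and "\<And>z. z \<in> regular_points F \<Omega> \<Longrightarrow> local_solution_manifold F \<Omega> z (S z)"
  defines "T \<equiv> generalized_solution F \<Omega> S x0"
    and "M \<equiv> connected_component_set {x \<in> closure \<Omega>. F x = 0} x0"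
  shows "x0 \<in> frontier M \<and>
         (\<forall>T\<^sub>\<alpha> \<in> limit_sets F \<Omega> S x0.
            x0 \<in> T\<^sub>\<alpha> \<and> T\<^sub>\<alpha> \<subseteq> T \<and> T \<subseteq> connected_component_set (frontier M) x0) \<and>
         (\<forall>x\<in>T. \<forall>j. F x $ j = 0)"
proof -
  define Z where "Z = {x \<in> closure \<Omega>. F x = 0}"
  have M: "M = connected_component_set Z x0" by (simp add: M_def Z_def)
  have "closed Z"
    unfolding Z_def using assms(7) continuous_closed_preimage_constant by blast
  then have "closed M" unfolding M by (rule closed_connected_component)
  have MZ: "M \<subseteq> Z" unfolding M by (rule connected_component_subset)
  have "x0 \<in> Z" using assms closure_subset by (auto simp: Z_def)
  then have "x0 \<in> M" unfolding M by (simp add: connected_component_refl)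
  have "regular_points F \<Omega> \<inter> interior M = {}"
    using MZ by (intro regular_points_disjoint_interior_zeros) (auto simp: Z_def)
  \<comment> \<open>An open set that misses a set also misses its closure. The closure is what
    matters below, where only limits of regular points are available.\<close>
  then have reg: "closure (regular_points F \<Omega>) \<inter> interior M = {}"
    by (metis inf_commute open_Int_closure_eq_empty open_interior)
  \<comment> \<open>With \<open>M\<close> closed, lying in the frontier splits into two separate
    tasks: being in \<open>M\<close> and avoiding its interior.\<close>
  have frontier: "frontier M = M - interior M"
    using \<open>closed M\<close> by (simp add: frontier_def)
  \<comment> \<open>This comes directly from a regular sequence, without reference to any limit set.
    It also makes the component of \<open>frontier M\<close> at \<open>x0\<close> nonempty.\<close>
  have x0: "x0 \<in> frontier M"
  proof -
    obtain x where "\<And>n. x n \<in> regular_points F \<Omega>" "x \<longlonglongrightarrow> x0"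
      using assms(9) by (auto simp: regular_sequence_def)
    then have "x0 \<in> closure (regular_points F \<Omega>)" by (auto simp: closure_sequential)
    with reg \<open>x0 \<in> M\<close> show ?thesis by (auto simp: frontier)
  qed
  have limit: "x0 \<in> K \<and> connected K \<and> K \<subseteq> frontier M"
    if limit_set: "K \<in> limit_sets F \<Omega> S x0" for K
  proof -
    obtain x' r where x': "regular_sequence F \<Omega> x0 x'" "strict_mono r"
        and K': "hausdorff_limit (\<lambda>n. closure (S (x' (r n)))) K"
      using limit_set by (auto simp: limit_sets_def)
    \<comment> \<open>A subsequence of a regular sequence is again regular, so \<open>r\<close> can
      be absorbed.\<close>
    define x where "x = x' \<circ> r"
    define C where "C = (\<lambda>n. closure (S (x n)))"
    have K: "hausdorff_limit C K" using K' by (simp add: x_def C_def)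
    have x: "\<And>n. x n \<in> regular_points F \<Omega>" and lim: "x \<longlonglongrightarrow> x0"
      using x' LIMSEQ_subseq_LIMSEQ by (auto simp: regular_sequence_def x_def)
    have S: "connected (S (x n))" "x n \<in> S (x n)" "S (x n) \<subseteq> regular_points F \<Omega>"
        "\<forall>y\<in>S (x n). F y = F (x n)" for n
      using assms(10)[OF x] by (auto simp: local_solution_manifold_def)
    have C_reg: "C n \<subseteq> closure (regular_points F \<Omega>)" for n
      unfolding C_def using S(3)[of n] by (rule closure_mono)
    have "regular_points F \<Omega> \<subseteq> \<Omega>" by (auto simp: regular_points_def)
    then have C_sub: "C n \<subseteq> closure \<Omega>" for n
      using C_reg[of n] closure_mono by blast
    have bdd: "bounded (C n)" for n
      using bounded_closure[OF assms(4)] C_sub[of n] by (rule bounded_subset)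
    have mem: "x n \<in> C n" for n
      unfolding C_def using S(2)[of n] closure_subset by blast
    have ne: "C n \<noteq> {}" for n using mem[of n] by auto
    have "connected (C n)" for n
      unfolding C_def using S(1)[of n] by (rule connected_imp_connected_closure)
    then have conn: "connected K" using hausdorff_limit_connected[of C K] K bdd ne by simp
    have in_K: "x0 \<in> K" by (rule hausdorff_limit_contains_limits[of C K x, OF K bdd mem lim])
    \<comment> \<open>\<open>C n\<close> may reach the boundary of \<open>\<Omega>\<close>;
      continuity of \<open>F\<close> up to the boundary carries the constant value from
      \<open>S (x n)\<close> to its closure.\<close>
    have F_C: "F y = F (x n)" if "y \<in> C n" for y n
    proof (rule continuous_constant_on_closure[where f = F])
      show "continuous_on (closure (S (x n))) F"
        using assms(7) C_sub[of n] unfolding C_def by (rule continuous_on_subset)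
      show "y \<in> closure (S (x n))" using that by (simp add: C_def)
    qed (use S(4) in auto)
    have xcl: "x n \<in> closure \<Omega>" for n using mem[of n] C_sub[of n] by blast
    have x0cl: "x0 \<in> closure \<Omega>" using assms(5) closure_subset by blast
    \<comment> \<open>Approximate \<open>y\<close> by points \<open>t n\<close> of
      \<open>C n\<close>. The values \<open>F (t n)\<close> and \<open>F (x n)\<close> agree, so
      their limits \<open>F y\<close> and \<open>F x0 = 0\<close> agree. The \<open>t n\<close> need
      not be regular, but they are in the closure of the regular points, and hence so is
      \<open>y\<close>.\<close>
    have FK: "y \<in> Z \<and> y \<notin> interior M" if y: "y \<in> K" for y
    proof -
      obtain t where t: "\<And>n. t n \<in> C n" "t \<longlonglongrightarrow> y"
        using hausdorff_limit_point_sequence[of C K y, OF K ne y] by blast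
      have tcl: "t n \<in> closure \<Omega>" for n using t(1)[of n] C_sub[of n] by blast
      have ycl: "y \<in> closure \<Omega>" by (rule closed_sequentially[OF closed_closure tcl t(2)])
      have "(\<lambda>n. F (t n)) \<longlonglongrightarrow> F y"
        by (rule continuous_on_tendsto_compose[OF assms(7) t(2) ycl]) (simp add: tcl)
      moreover have "(\<lambda>n. F (x n)) \<longlonglongrightarrow> F x0"
        by (rule continuous_on_tendsto_compose[OF assms(7) lim x0cl]) (simp add: xcl)
      moreover have "(\<lambda>n. F (t n)) = (\<lambda>n. F (x n))" by (intro ext F_C t(1))
      ultimately have "F y = 0" using assms(8) by (auto dest: LIMSEQ_unique)
      moreover have "y \<in> closure (regular_points F \<Omega>)"
        using closed_closure
      proof (rule closed_sequentially)
        show "t n \<in> closure (regular_points F \<Omega>)" for n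
          using t(1)[of n] C_reg[of n] by blast
      qed (rule t(2))
      ultimately show ?thesis using ycl reg by (auto simp: Z_def)
    qed
    \<comment> \<open>\<open>K\<close> is a connected set of zeros through \<open>x0\<close>, and
      \<open>M\<close> is the largest such set.\<close>
    then have "K \<subseteq> M" unfolding M using conn in_K by (intro connected_component_maximal) auto
    then show ?thesis using conn in_K FK frontier by blast
  qed
  \<comment> \<open>The same maximality, now inside \<open>frontier M\<close>, applies to each limit
    set separately and therefore to their union.\<close>
  have T_sub: "T \<subseteq> connected_component_set (frontier M) x0"
    unfolding T_def generalized_solution_def
    using limit by (intro Union_least connected_component_maximal) auto
  moreover have "F y = 0" if "y \<in> T" for y
    using that T_sub connected_component_subset frontier MZ by (force simp: Z_def)
  moreover have "K \<subseteq> T" if "K \<in> limit_sets F \<Omega> S x0" for K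
    using that by (auto simp: T_def generalized_solution_def)
  ultimately show ?thesis using x0 limit by simp
qed

end
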